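(* For each object $(S,R)$ of $\mathcal{E}$, let $\theta_{(S,R)}:R\to Q(S,R)$ be the canonical map to the quotient. Then $\theta=(\theta_{(S,R)})_{(S,R)\in \mathrm{Ob}\,\mathcal{E}}$ is a natural transformation from the functor $V:\mathcal{E}\to\mathcal{CR}_1$ to the functor $Q:\mathcal{E}\to\mathcal{CR}_1$.
   Context: "Ring" means commutative ring, not necessarily with identity. Prime ideals are proper by definition. $N(S)$ denotes the nilradical of a ring $S$, i.e. the intersection of all prime ideals of $S$ (equal to $S$ if there are none). $\mathcal{CR}_1$ is the category of unitary commutative rings and homomorphisms of unitary rings. An i-extension of $S$ is a ring $R$ containing $S$ as an ideal. For an i-extension $R$ of $S$ and an ideal $I$ of $S$, put $\psi_{(S,R)}(I)=\{x\in R: xS\subseteq I\}$, an ideal of $R$. $\mathcal{E}$ is the category whose objects are the pairs $(S,R)$ with $R$ a unitary ring that is an i-extension of the ring $S$, and whose morphisms $(S_1,R_1)\to(S_2,R_2)$ are the homomorphisms of unitary rings $h:R_1\to R_2$ such that $h(S_1)=S_2$. The functor $V:\mathcal{E}\to\mathcal{CR}_1$ sends $(S,R)$ to $R$ and a morphism $h:(S,R)\to(T,M)$ to $h:R\to M$. The functor $Q:\mathcal{E}\to\mathcal{CR}_1$ sends $(S,R)$ to $Q(S,R)=R/\psi_{(S,R)}(N(S))$ and $h:(S,R)\to(T,M)$ to $Q(h): r+\psi_{(S,R)}(N(S))\mapsto h(r)+\psi_{(T,M)}(N(T))$. *)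

theory Defs
  imports "HOL-Algebra.Weak_Morphisms"
begin

section \<open>Categories, functors, natural transformations\<close>

text \<open>
  Identities and composition carry the objects as arguments, so arrows of different hom-sets need
  not be disjoint: an arrow \<open>X \<rightarrow> Y\<close> is an element of \<open>Hom C X Y\<close> together with \<open>X\<close> and \<open>Y\<close>.
  \<open>Comp C X Y Z g f\<close> is \<open>g\<close> after \<open>f\<close>, for \<open>f : X \<rightarrow> Y\<close> and \<open>g : Y \<rightarrow> Z\<close>.
\<close>

record ('o, 'm) cat =
  Obj :: "'o set"
  Hom :: "'o \<Rightarrow> 'o \<Rightarrow> 'm set"
  Ident :: "'o \<Rightarrow> 'm"
  Comp :: "'o \<Rightarrow> 'o \<Rightarrow> 'o \<Rightarrow> 'm \<Rightarrow> 'm \<Rightarrow> 'm"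

locale category =
  fixes C :: "('o, 'm) cat"
  assumes Ident_in_Hom: "X \<in> Obj C \<Longrightarrow> Ident C X \<in> Hom C X X"
    and Comp_in_Hom:
      "\<lbrakk>X \<in> Obj C; Y \<in> Obj C; Z \<in> Obj C; f \<in> Hom C X Y; g \<in> Hom C Y Z\<rbrakk>
        \<Longrightarrow> Comp C X Y Z g f \<in> Hom C X Z"
    and Comp_Ident_left:
      "\<lbrakk>X \<in> Obj C; Y \<in> Obj C; f \<in> Hom C X Y\<rbrakk> \<Longrightarrow> Comp C X Y Y (Ident C Y) f = f"
    and Comp_Ident_right:
      "\<lbrakk>X \<in> Obj C; Y \<in> Obj C; f \<in> Hom C X Y\<rbrakk> \<Longrightarrow> Comp C X X Y f (Ident C X) = f"
    and Comp_assoc: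
      "\<lbrakk>W \<in> Obj C; X \<in> Obj C; Y \<in> Obj C; Z \<in> Obj C;
        f \<in> Hom C W X; g \<in> Hom C X Y; h \<in> Hom C Y Z\<rbrakk>
        \<Longrightarrow> Comp C W Y Z h (Comp C W X Y g f) = Comp C W X Z (Comp C X Y Z h g) f"

record ('o, 'm, 'p, 'n) ftor =
  on_obj :: "'o \<Rightarrow> 'p"
  on_arr :: "'o \<Rightarrow> 'o \<Rightarrow> 'm \<Rightarrow> 'n"

locale cat_functor = C: category C + D: category D
  for C :: "('o, 'm) cat" and D :: "('p, 'n) cat" +
  fixes F :: "('o, 'm, 'p, 'n) ftor"
  assumes on_obj_in_Obj: "X \<in> Obj C \<Longrightarrow> on_obj F X \<in> Obj D"
    and on_arr_in_Hom:
      "\<lbrakk>X \<in> Obj C; Y \<in> Obj C; f \<in> Hom C X Y\<rbrakk>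
        \<Longrightarrow> on_arr F X Y f \<in> Hom D (on_obj F X) (on_obj F Y)"
    and on_arr_Ident: "X \<in> Obj C \<Longrightarrow> on_arr F X X (Ident C X) = Ident D (on_obj F X)"
    and on_arr_Comp:
      "\<lbrakk>X \<in> Obj C; Y \<in> Obj C; Z \<in> Obj C; f \<in> Hom C X Y; g \<in> Hom C Y Z\<rbrakk>
        \<Longrightarrow> on_arr F X Z (Comp C X Y Z g f) =
          Comp D (on_obj F X) (on_obj F Y) (on_obj F Z) (on_arr F Y Z g) (on_arr F X Y f)"

locale natural_transformation = F: cat_functor C D F + G: cat_functor C D G
  for C :: "('o, 'm) cat" and D :: "('p, 'n) cat"
    and F G :: "('o, 'm, 'p, 'n) ftor" +
  fixes \<tau> :: "'o \<Rightarrow> 'n"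
  assumes component_in_Hom: "X \<in> Obj C \<Longrightarrow> \<tau> X \<in> Hom D (on_obj F X) (on_obj G X)"
    and naturality:
      "\<lbrakk>X \<in> Obj C; Y \<in> Obj C; f \<in> Hom C X Y\<rbrakk>
        \<Longrightarrow> Comp D (on_obj F X) (on_obj F Y) (on_obj G Y) (\<tau> Y) (on_arr F X Y f) =
          Comp D (on_obj F X) (on_obj G X) (on_obj G Y) (on_arr G X Y f) (\<tau> X)"


section \<open>Commutative rings not necessarily with identity\<close>

text \<open>
  Such rings are also represented by the record type \<open>ring\<close>; its field \<open>one\<close> is then unconstrained
  and unused. Unitary commutative rings are the library's \<open>cring\<close> (the zero ring is allowed).
\<close>

locale comm_rng = abelian_group R for R :: "('a, 'b) ring_scheme" (structure) +
  assumes rng_m_closed: "\<lbrakk>x \<in> carrier R; y \<in> carrier R\<rbrakk> \<Longrightarrow> x \<otimes> y \<in> carrier R"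
    and rng_m_assoc:
      "\<lbrakk>x \<in> carrier R; y \<in> carrier R; z \<in> carrier R\<rbrakk> \<Longrightarrow> (x \<otimes> y) \<otimes> z = x \<otimes> (y \<otimes> z)"
    and rng_m_comm: "\<lbrakk>x \<in> carrier R; y \<in> carrier R\<rbrakk> \<Longrightarrow> x \<otimes> y = y \<otimes> x"
    and rng_l_distr:
      "\<lbrakk>x \<in> carrier R; y \<in> carrier R; z \<in> carrier R\<rbrakk> \<Longrightarrow> (x \<oplus> y) \<otimes> z = x \<otimes> z \<oplus> y \<otimes> z"

definition rng_ideal :: "'a set \<Rightarrow> ('a, 'b) ring_scheme \<Rightarrow> bool" where
  "rng_ideal I R \<longleftrightarrow> additive_subgroup I R \<and> (\<forall>a\<in>I. \<forall>x\<in>carrier R. x \<otimes>\<^bsub>R\<^esub> a \<in> I)"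

definition rng_primeideal :: "'a set \<Rightarrow> ('a, 'b) ring_scheme \<Rightarrow> bool" where
  "rng_primeideal P R \<longleftrightarrow> rng_ideal P R \<and> P \<noteq> carrier R \<and>
    (\<forall>a\<in>carrier R. \<forall>b\<in>carrier R. a \<otimes>\<^bsub>R\<^esub> b \<in> P \<longrightarrow> a \<in> P \<or> b \<in> P)"

definition nilradical :: "('a, 'b) ring_scheme \<Rightarrow> 'a set" where
  "nilradical S = {x \<in> carrier S. \<forall>P. rng_primeideal P S \<longrightarrow> x \<in> P}"

text \<open>
  \<open>R\<close> contains \<open>S\<close> as an ideal; equality of the additive and multiplicative structures can only be
  required on the carrier of \<open>S\<close>.
\<close>

definition i_extension :: "('a, 'b) ring_scheme \<Rightarrow> ('a, 'c) ring_scheme \<Rightarrow> bool" where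
  "i_extension S R \<longleftrightarrow> comm_rng S \<and> comm_rng R \<and> rng_ideal (carrier S) R \<and>
    (\<forall>x\<in>carrier S. \<forall>y\<in>carrier S. x \<oplus>\<^bsub>S\<^esub> y = x \<oplus>\<^bsub>R\<^esub> y \<and> x \<otimes>\<^bsub>S\<^esub> y = x \<otimes>\<^bsub>R\<^esub> y)"

definition psi :: "('a, 'b) ring_scheme \<Rightarrow> ('a, 'c) ring_scheme \<Rightarrow> 'a set \<Rightarrow> 'a set" where
  "psi S R I = {x \<in> carrier R. \<forall>s\<in>carrier S. x \<otimes>\<^bsub>R\<^esub> s \<in> I}"


section \<open>The categories\<close>

text \<open>
  An arrow is a function that is \<open>undefined\<close> outside the carrier of its domain, so that
  equality of arrows is equality as maps between the carriers.
\<close>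

definition CR1 :: "('a ring, 'a \<Rightarrow> 'a) cat" where
  "CR1 =
    \<lparr> Obj = {R. cring R},
      Hom = (\<lambda>R T. ring_hom R T \<inter> extensional (carrier R)),
      Ident = (\<lambda>R. \<lambda>x\<in>carrier R. x),
      Comp = (\<lambda>R T U g f. compose (carrier R) g f) \<rparr>"

definition Ecat :: "('a ring \<times> 'a ring, 'a \<Rightarrow> 'a) cat" where
  "Ecat =
    \<lparr> Obj = {(S, R). cring R \<and> i_extension S R},
      Hom = (\<lambda>(S, R) (T, M).
        {h \<in> ring_hom R M \<inter> extensional (carrier R). h ` carrier S = carrier T}),
      Ident = (\<lambda>(S, R). \<lambda>x\<in>carrier R. x),
      Comp = (\<lambda>(S, R) Y Z g f. compose (carrier R) g f) \<rparr>"


section \<open>The functors and the canonical maps\<close>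

text \<open>
  For rings over a type \<open>'a\<close> the quotient ring \<open>R Quot I\<close> has carrier type \<open>'a set\<close>. As both functors
  must end in the same category, that category is \<open>CR1\<close> over the type \<open>'a + 'a set\<close> of elements and
  cosets: an element \<open>r\<close> occurs as \<open>Inl r\<close> and a coset \<open>I +> r\<close> as \<open>Inr (I +> r)\<close>. For injective \<open>f\<close>,
  \<open>image_ring f R\<close> is \<open>R\<close> with its elements renamed along \<open>f\<close>.
\<close>

definition psi_nil :: "'a ring \<times> 'a ring \<Rightarrow> 'a set" where
  "psi_nil = (\<lambda>(S, R). psi S R (nilradical S))"

definition V_obj :: "'a ring \<times> 'a ring \<Rightarrow> ('a + 'a set) ring" where
  "V_obj = (\<lambda>(S, R). image_ring Inl R)"

definition V_arr ::
  "'a ring \<times> 'a ring \<Rightarrow> 'a ring \<times> 'a ring \<Rightarrow> ('a \<Rightarrow> 'a) \<Rightarrow> 'a + 'a set \<Rightarrow> 'a + 'a set" where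
  "V_arr X Y h = (\<lambda>u \<in> carrier (V_obj X). Inl (h (projl u)))"

definition Q_obj :: "'a ring \<times> 'a ring \<Rightarrow> ('a + 'a set) ring" where
  "Q_obj = (\<lambda>(S, R). image_ring Inr (R Quot psi_nil (S, R)))"

text \<open>
  \<open>Q_arr X Y h\<close> sends the coset \<open>c\<close> to the common value of \<open>psi_nil Y +> h r\<close> for all \<open>r \<in> c\<close>;
  that there is only one such value is \<open>Q_arr_coset\<close> below.
\<close>

definition Q_arr ::
  "'a ring \<times> 'a ring \<Rightarrow> 'a ring \<times> 'a ring \<Rightarrow> ('a \<Rightarrow> 'a) \<Rightarrow> 'a + 'a set \<Rightarrow> 'a + 'a set" where
  "Q_arr X Y h = (\<lambda>u \<in> carrier (Q_obj X).
    Inr (the_elem ((\<lambda>r. psi_nil Y +>\<^bsub>snd Y\<^esub> h r) ` projr u)))"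

definition V_functor :: "('a ring \<times> 'a ring, 'a \<Rightarrow> 'a, ('a + 'a set) ring, 'a + 'a set \<Rightarrow> 'a + 'a set) ftor"
  where "V_functor = \<lparr> on_obj = V_obj, on_arr = V_arr \<rparr>"

definition Q_functor :: "('a ring \<times> 'a ring, 'a \<Rightarrow> 'a, ('a + 'a set) ring, 'a + 'a set \<Rightarrow> 'a + 'a set) ftor"
  where "Q_functor = \<lparr> on_obj = Q_obj, on_arr = Q_arr \<rparr>"

definition theta :: "'a ring \<times> 'a ring \<Rightarrow> 'a + 'a set \<Rightarrow> 'a + 'a set" where
  "theta X = (\<lambda>u \<in> carrier (V_obj X). Inr (psi_nil X +>\<^bsub>snd X\<^esub> projl u))"


section \<open>Well-definedness of the quotient functor\<close>

lemma Ecat_objD: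
  assumes "(S, R) \<in> Obj Ecat"
  shows "cring R" and "comm_rng S" and "rng_ideal (carrier S) R"
    and "\<And>x y. x \<in> carrier S \<Longrightarrow> y \<in> carrier S \<Longrightarrow> x \<oplus>\<^bsub>S\<^esub> y = x \<oplus>\<^bsub>R\<^esub> y"
    and "\<And>x y. x \<in> carrier S \<Longrightarrow> y \<in> carrier S \<Longrightarrow> x \<otimes>\<^bsub>S\<^esub> y = x \<otimes>\<^bsub>R\<^esub> y"
  using assms by (auto simp: Ecat_def i_extension_def)

lemma Ecat_zero:
  assumes X: "(S, R) \<in> Obj Ecat"
  shows "\<zero>\<^bsub>S\<^esub> = \<zero>\<^bsub>R\<^esub>"
proof -
  interpret R: cring R using Ecat_objD(1)[OF X] .
  interpret S: comm_rng S using Ecat_objD(2)[OF X] .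
  interpret I: additive_subgroup "carrier S" R
    using Ecat_objD(3)[OF X] by (simp add: rng_ideal_def)
  have z: "\<zero>\<^bsub>S\<^esub> \<in> carrier R" using I.a_subset by auto
  have "\<zero>\<^bsub>S\<^esub> \<oplus>\<^bsub>R\<^esub> \<zero>\<^bsub>S\<^esub> = \<zero>\<^bsub>S\<^esub>"
    using Ecat_objD(4)[OF X, of "\<zero>\<^bsub>S\<^esub>" "\<zero>\<^bsub>S\<^esub>"] by simp
  with z show ?thesis by (metis R.add.l_cancel_one')
qed

lemma psi_nil_ideal:
  assumes X: "(S, R) \<in> Obj Ecat"
  shows "ideal (psi_nil (S, R)) R"
proof -
  interpret R: cring R using Ecat_objD(1)[OF X] .
  interpret S: comm_rng S using Ecat_objD(2)[OF X] .
  have idS: "rng_ideal (carrier S) R" using Ecat_objD(3)[OF X] .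
  interpret I: additive_subgroup "carrier S" R using idS by (simp add: rng_ideal_def)
  have sR: "s \<in> carrier R" if "s \<in> carrier S" for s using I.a_subset that by auto
  have absorb: "r \<otimes>\<^bsub>R\<^esub> s \<in> carrier S" if "r \<in> carrier R" "s \<in> carrier S" for r s
    using idS that by (auto simp: rng_ideal_def)
  have N_zero: "\<zero>\<^bsub>R\<^esub> \<in> nilradical S"
    unfolding nilradical_def Ecat_zero[OF X, symmetric]
    by (auto simp: rng_primeideal_def rng_ideal_def additive_subgroup.zero_closed)
  have N_add: "a \<oplus>\<^bsub>R\<^esub> b \<in> nilradical S" if "a \<in> nilradical S" "b \<in> nilradical S" for a b
  proof -
    have "a \<oplus>\<^bsub>S\<^esub> b \<in> nilradical S"
      using that unfolding nilradical_def
      by (auto simp: rng_primeideal_def rng_ideal_def additive_subgroup.a_closed)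
    then show ?thesis using that Ecat_objD(4)[OF X, of a b] by (simp add: nilradical_def)
  qed
  show ?thesis
  proof (rule idealI)
    show "ring R" by (rule R.ring_axioms)
    show "subgroup (psi_nil (S, R)) (add_monoid R)"
    proof (rule R.add.subgroupI)
      show "psi_nil (S, R) \<subseteq> carrier R" by (auto simp: psi_nil_def psi_def)
      show "psi_nil (S, R) \<noteq> {}" using N_zero sR by (force simp: psi_nil_def psi_def)
    next
      fix a assume a: "a \<in> psi_nil (S, R)"
      have "(\<ominus>\<^bsub>R\<^esub> a) \<otimes>\<^bsub>R\<^esub> s \<in> nilradical S" if s: "s \<in> carrier S" for s
      proof -
        have "(\<ominus>\<^bsub>R\<^esub> a) \<otimes>\<^bsub>R\<^esub> s = a \<otimes>\<^bsub>R\<^esub> (\<ominus>\<^bsub>R\<^esub> s)"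
          using a sR[OF s] by (simp add: psi_nil_def psi_def R.l_minus R.r_minus)
        then show ?thesis using a s I.a_inv_closed by (auto simp: psi_nil_def psi_def)
      qed
      then show "\<ominus>\<^bsub>R\<^esub> a \<in> psi_nil (S, R)" using a by (simp add: psi_nil_def psi_def)
    next
      fix a b assume "a \<in> psi_nil (S, R)" "b \<in> psi_nil (S, R)"
      then show "a \<oplus>\<^bsub>R\<^esub> b \<in> psi_nil (S, R)"
        using N_add sR by (simp add: psi_nil_def psi_def R.l_distr)
    qed
  next
    fix a x assume a: "a \<in> psi_nil (S, R)" and x: "x \<in> carrier R"
    have "(a \<otimes>\<^bsub>R\<^esub> x) \<otimes>\<^bsub>R\<^esub> s \<in> nilradical S" if s: "s \<in> carrier S" for s
      using a x s absorb[OF x s] sR[OF s] by (simp add: psi_nil_def psi_def R.m_assoc)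
    then show ax: "a \<otimes>\<^bsub>R\<^esub> x \<in> psi_nil (S, R)" using a x by (simp add: psi_nil_def psi_def)
    then show "x \<otimes>\<^bsub>R\<^esub> a \<in> psi_nil (S, R)"
      using a x by (simp add: R.m_comm psi_nil_def psi_def)
  qed
qed

lemma Ecat_arr_psi_nil:
  assumes X: "(S, R) \<in> Obj Ecat" and Y: "(T, M) \<in> Obj Ecat"
    and h: "h \<in> Hom Ecat (S, R) (T, M)" and x: "x \<in> psi_nil (S, R)"
  shows "h x \<in> psi_nil (T, M)"
proof -
  interpret R: cring R using Ecat_objD(1)[OF X] .
  interpret S: comm_rng S using Ecat_objD(2)[OF X] .
  interpret M: cring M using Ecat_objD(1)[OF Y] .
  interpret T: comm_rng T using Ecat_objD(2)[OF Y] .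
  have SR: "s \<in> carrier R" if "s \<in> carrier S" for s
    using Ecat_objD(3)[OF X] that additive_subgroup.a_subset by (auto simp: rng_ideal_def)
  have hom: "h \<in> ring_hom R M" and img: "h ` carrier S = carrier T"
    using h by (auto simp: Ecat_def)
  have hT: "h s \<in> carrier T" if "s \<in> carrier S" for s using img that by auto
  have hadd: "h (a \<oplus>\<^bsub>S\<^esub> b) = h a \<oplus>\<^bsub>T\<^esub> h b" if "a \<in> carrier S" "b \<in> carrier S" for a b
    using that by (simp add: Ecat_objD(4)[OF X] Ecat_objD(4)[OF Y] hT SR ring_hom_add[OF hom])
  have hmult: "h (a \<otimes>\<^bsub>S\<^esub> b) = h a \<otimes>\<^bsub>T\<^esub> h b" if "a \<in> carrier S" "b \<in> carrier S" for a b
    using that by (simp add: Ecat_objD(5)[OF X] Ecat_objD(5)[OF Y] hT SR ring_hom_mult[OF hom])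
  interpret h: group_hom "add_monoid S" "add_monoid T" h
    by unfold_locales (auto simp: hom_def hT hadd)
  have N: "h n \<in> nilradical T" if n: "n \<in> nilradical S" for n
  proof -
    have "h n \<in> P" if P: "rng_primeideal P T" for P
    proof -
      let ?P = "{s \<in> carrier S. h s \<in> P}"
      interpret P: additive_subgroup P T
        using P by (simp add: rng_primeideal_def rng_ideal_def)
      have "subgroup ?P (add_monoid S)"
      proof (rule S.add.subgroupI)
        have "\<zero>\<^bsub>S\<^esub> \<in> ?P" using h.hom_one P.zero_closed by simp
        then show "?P \<noteq> {}" by blast
      next
        fix a assume a: "a \<in> ?P"
        then have "h (\<ominus>\<^bsub>S\<^esub> a) = \<ominus>\<^bsub>T\<^esub> h a" using h.hom_inv[of a] by (simp add: a_inv_def)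
        with a show "\<ominus>\<^bsub>S\<^esub> a \<in> ?P" by (simp add: P.a_inv_closed)
      qed (auto simp: hadd)
      then have ideal: "rng_ideal ?P S"
        using P hT unfolding rng_ideal_def rng_primeideal_def
        by (auto simp: additive_subgroup_def hmult S.rng_m_closed)
      have "?P \<noteq> carrier S"
      proof
        assume "?P = carrier S"
        then have "h ` carrier S \<subseteq> P" by blast
        then have "carrier T \<subseteq> P" using img by simp
        then show False using P P.a_subset by (auto simp: rng_primeideal_def)
      qed
      with ideal P have "rng_primeideal ?P S"
        unfolding rng_primeideal_def by (auto simp: hmult hT)
      then show ?thesis using n by (auto simp: nilradical_def)
    qed
    then show ?thesis using n hT by (auto simp: nilradical_def)
  qed
  have "h x \<otimes>\<^bsub>M\<^esub> t \<in> nilradical T" if t: "t \<in> carrier T" for t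
  proof -
    obtain s where s: "s \<in> carrier S" "t = h s" using t img by blast
    have "h (x \<otimes>\<^bsub>R\<^esub> s) \<in> nilradical T" using x s N by (simp add: psi_nil_def psi_def)
    then show ?thesis using x s SR by (simp add: ring_hom_mult[OF hom] psi_nil_def psi_def)
  qed
  then show ?thesis using x ring_hom_closed[OF hom] by (simp add: psi_nil_def psi_def)
qed

lemma Q_obj_carrier: "carrier (Q_obj (S, R)) = (\<lambda>r. Inr (psi_nil (S, R) +>\<^bsub>R\<^esub> r)) ` carrier R"
  by (auto simp: Q_obj_def image_ring_carrier FactRing_def A_RCOSETS_def RCOSETS_def a_r_coset_def)

lemma Q_arr_coset:
  assumes X: "(S, R) \<in> Obj Ecat" and Y: "(T, M) \<in> Obj Ecat"
    and h: "h \<in> Hom Ecat (S, R) (T, M)" and r: "r \<in> carrier R"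
  shows "Q_arr (S, R) (T, M) h (Inr (psi_nil (S, R) +>\<^bsub>R\<^esub> r)) = Inr (psi_nil (T, M) +>\<^bsub>M\<^esub> h r)"
proof -
  interpret I: ideal "psi_nil (S, R)" R using psi_nil_ideal[OF X] .
  interpret J: ideal "psi_nil (T, M)" M using psi_nil_ideal[OF Y] .
  have hom: "h \<in> ring_hom R M" using h by (simp add: Ecat_def)
  have "psi_nil (T, M) +>\<^bsub>M\<^esub> h r' = psi_nil (T, M) +>\<^bsub>M\<^esub> h r"
    if r': "r' \<in> psi_nil (S, R) +>\<^bsub>R\<^esub> r" for r'
  proof -
    obtain i where i: "i \<in> psi_nil (S, R)" "r' = i \<oplus>\<^bsub>R\<^esub> r"
      using r' by (auto simp: a_r_coset_defs)
    then have "h r' = h i \<oplus>\<^bsub>M\<^esub> h r" using r by (simp add: ring_hom_add[OF hom])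
    then have "h r' \<in> psi_nil (T, M) +>\<^bsub>M\<^esub> h r"
      using Ecat_arr_psi_nil[OF X Y h i(1)] by (auto simp: a_r_coset_defs)
    then show ?thesis
      by (rule J.a_repr_independence'[OF _ ring_hom_closed[OF hom r], symmetric])
  qed
  moreover have "r \<in> psi_nil (S, R) +>\<^bsub>R\<^esub> r" using I.a_rcos_self[OF r] .
  ultimately have "(\<lambda>r'. psi_nil (T, M) +>\<^bsub>M\<^esub> h r') ` (psi_nil (S, R) +>\<^bsub>R\<^esub> r)
      = {psi_nil (T, M) +>\<^bsub>M\<^esub> h r}"
    by blast
  then show ?thesis using r by (auto simp: Q_arr_def Q_obj_carrier)
qed

end

theory Submission
  imports Defs
begin

text \<open>
  For an object \<open>X = (S, R)\<close>, both \<open>Inl\<close> and \<open>r \<mapsto> Inr (psi_nil X +> r)\<close> are surjective ring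
  homomorphisms from \<open>R\<close> onto \<open>V_obj X\<close> and \<open>Q_obj X\<close>. Every map in the statement is determined by
  its composite with one of these surjections, and it is a homomorphism as soon as this composite
  is one; so all functor laws and the naturality square reduce to identities between maps on \<open>R\<close>.
\<close>

text \<open>Arguments in \<open>A\<close> lift along the surjection \<open>p\<close> to
  \<open>R\<close>, where \<open>f\<close> is computed by the homomorphism \<open>g\<close>. The
  equation \<open>f (p r) = g r\<close> makes \<open>g\<close> constant on the fibres of
  \<open>p\<close>, which takes the place of a kernel condition.\<close>

lemma ring_hom_factor:
  assumes "ring R" and p: "p \<in> ring_hom R A" "p ` carrier R = carrier A"
    and g: "g \<in> ring_hom R B" and f: "\<And>r. r \<in> carrier R \<Longrightarrow> f (p r) = g r"
  shows "f \<in> ring_hom A B"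
proof -
  interpret R: ring R by fact
  show ?thesis
  proof (rule ring_hom_memI)
    fix x assume "x \<in> carrier A"
    then obtain r where r: "r \<in> carrier R" "x = p r" using p(2) by blast
    then show "f x \<in> carrier B" using ring_hom_closed[OF g] by (simp add: f)
  next
    fix x y assume "x \<in> carrier A" "y \<in> carrier A"
    then obtain r s where rs: "r \<in> carrier R" "x = p r" "s \<in> carrier R" "y = p s"
      using p(2) by blast
    then show "f (x \<otimes>\<^bsub>A\<^esub> y) = f x \<otimes>\<^bsub>B\<^esub> f y"
      by (simp add: f ring_hom_mult[OF p(1), symmetric] ring_hom_mult[OF g])
    from rs show "f (x \<oplus>\<^bsub>A\<^esub> y) = f x \<oplus>\<^bsub>B\<^esub> f y"
      by (simp add: f ring_hom_add[OF p(1), symmetric] ring_hom_add[OF g])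
  next
    show "f \<one>\<^bsub>A\<^esub> = \<one>\<^bsub>B\<^esub>"
      using f[of "\<one>\<^bsub>R\<^esub>"] by (simp add: ring_hom_one[OF p(1)] ring_hom_one[OF g])
  qed
qed

section \<open>Renamed rings and the two surjections\<close>

lemma image_ring_hom: "inj f \<Longrightarrow> f \<in> ring_hom R (image_ring f R)"
  using inj_imp_image_ring_iso[of f R] by (auto simp: ring_iso_def intro: inj_on_subset)

lemma (in cring) image_ring_cring:
  assumes "inj f"
  shows "cring (image_ring f R)"
  \<comment> \<open>The rule yields a \<open>cring\<close> whose \<open>one\<close> and
    \<open>zero\<close> are overwritten by the images of those of \<open>R\<close>; unfolding
    \<open>image_ring\<close> shows that these fields already hold these values.\<close>
  using ring_iso_imp_img_cring[OF inj_imp_image_ring_iso[OF inj_on_subset[OF assms subset_UNIV]]]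
  by (simp add: image_ring_def image_group_def monoid.defs)

lemma Inl_V_obj: "Inl \<in> ring_hom R (V_obj (S, R))"
  by (simp add: V_obj_def image_ring_hom)

lemma V_obj_carrier: "carrier (V_obj (S, R)) = Inl ` carrier R"
  by (simp add: V_obj_def image_ring_carrier)

text \<open>This is the projection modulo the ideal \<open>psi_nil (S, R)\<close>, followed by the
  renaming along \<open>Inr\<close>.\<close>

lemma coset_Q_obj:
  assumes "(S, R) \<in> Obj Ecat"
  shows "(\<lambda>r. Inr (psi_nil (S, R) +>\<^bsub>R\<^esub> r)) \<in> ring_hom R (Q_obj (S, R))"
  using ring_hom_trans[OF ideal.rcos_ring_hom[OF psi_nil_ideal[OF assms]] image_ring_hom[OF inj_Inr]]
  by (simp add: Q_obj_def comp_def)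

section \<open>Category laws\<close>

lemma Ecat_Hom: "Hom Ecat (S, R) (T, M) =
    {h \<in> ring_hom R M \<inter> extensional (carrier R). h ` carrier S = carrier T}"
  by (simp add: Ecat_def)

lemma Ecat_carrier_subset: "(S, R) \<in> Obj Ecat \<Longrightarrow> carrier S \<subseteq> carrier R"
  using Ecat_objD(3) additive_subgroup.a_subset by (fastforce simp: rng_ideal_def)

text \<open>Being a homomorphism depends only on values on \<open>carrier R\<close>, which is closed
  under the operations, so truncating the composite outside it is harmless.\<close>

lemma compose_ring_hom:
  assumes f: "f \<in> ring_hom R T" and g: "g \<in> ring_hom T U" and "ring R"
  shows "compose (carrier R) g f \<in> ring_hom R U"
  using ring.ring_hom_restrict[OF \<open>ring R\<close> ring_hom_trans[OF f g]] by (simp add: compose_def)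

lemma ident_ring_hom: "ring R \<Longrightarrow> (\<lambda>x\<in>carrier R. x) \<in> ring_hom R R"
  using ring.ring_hom_restrict[of R id R] by (simp add: id_ring_hom)

lemma category_CR1: "category CR1"
proof
  \<comment> \<open>The right-hand side truncates \<open>h\<close> after \<open>g\<close> to the
    carrier of \<open>X\<close>, where all values of \<open>f\<close> on the carrier of
    \<open>W\<close> lie.\<close>
  show "Comp CR1 W Y Z h (Comp CR1 W X Y g f) = Comp CR1 W X Z (Comp CR1 X Y Z h g) f"
    if "f \<in> Hom CR1 W X" for W X Y Z f g h
    using that by (auto simp: CR1_def compose_assoc[symmetric] ring_hom_def)
next
  show "Comp CR1 X Y Y (Ident CR1 Y) f = f" "Comp CR1 X X Y f (Ident CR1 X) = f"
    if "f \<in> Hom CR1 X Y" for X Y f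
    using that by (auto simp: CR1_def compose_def extensional_def ring_hom_closed fun_eq_iff)
qed (auto simp: CR1_def ident_ring_hom compose_ring_hom cring.axioms(1))

lemma category_Ecat: "category Ecat"
proof
  fix X :: "'a ring \<times> 'a ring"
  assume X: "X \<in> Obj Ecat"
  obtain S R where [simp]: "X = (S, R)" by force
  show "Ident Ecat X \<in> Hom Ecat X X"
    using X Ecat_carrier_subset[of S R] Ecat_objD(1)[of S R]
    by (auto simp: Ecat_def ident_ring_hom cring.axioms(1) image_def subset_iff)
next
  fix X Y Z :: "'a ring \<times> 'a ring" and f g
  assume X: "X \<in> Obj Ecat" and f: "f \<in> Hom Ecat X Y" and g: "g \<in> Hom Ecat Y Z"
  obtain S R T M U N where [simp]: "X = (S, R)" "Y = (T, M)" "Z = (U, N)" by (metis surj_pair)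
  \<comment> \<open>The truncation in \<open>compose\<close> does not touch
    \<open>carrier S\<close>, which lies in \<open>carrier R\<close>; so the composite again maps
    one ideal onto the other.\<close>
  have "compose (carrier R) g f ` carrier S = g ` f ` carrier S"
    using X Ecat_carrier_subset[of S R] by (force simp: compose_def)
  then show "Comp Ecat X Y Z g f \<in> Hom Ecat X Z"
    using X f g compose_ring_hom[of f R M g N] by (simp add: Ecat_def cring.axioms(1))
next
  fix X Y :: "'a ring \<times> 'a ring" and f
  assume f: "f \<in> Hom Ecat X Y"
  show "Comp Ecat X Y Y (Ident Ecat Y) f = f"
    using f by (cases X; cases Y)
      (auto simp: Ecat_def compose_def extensional_def ring_hom_closed fun_eq_iff)
  show "Comp Ecat X X Y f (Ident Ecat X) = f"
    using f by (cases X; cases Y) (auto simp: Ecat_def compose_def extensional_def fun_eq_iff)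
next
  fix W X Y Z :: "'a ring \<times> 'a ring" and f g h
  assume f: "f \<in> Hom Ecat W X"
  show "Comp Ecat W Y Z h (Comp Ecat W X Y g f) = Comp Ecat W X Z (Comp Ecat X Y Z h g) f"
    using f by (cases W; cases X) (auto simp: Ecat_def compose_assoc[symmetric] ring_hom_def)
qed

section \<open>The functors\<close>

lemma V_arr_Inl: "r \<in> carrier R \<Longrightarrow> V_arr (S, R) Y h (Inl r) = Inl (h r)"
  by (simp add: V_arr_def V_obj_carrier)

lemma V_arr_extensional: "V_arr X Y h \<in> extensional (carrier (V_obj X))"
  by (simp add: V_arr_def)

lemma Q_arr_extensional: "Q_arr X Y h \<in> extensional (carrier (Q_obj X))"
  by (simp add: Q_arr_def)

lemma cat_functor_V: "cat_functor Ecat CR1 V_functor"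
proof (intro cat_functor.intro category_Ecat category_CR1 cat_functor_axioms.intro)
  fix X :: "'a ring \<times> 'a ring"
  assume X: "X \<in> Obj Ecat"
  obtain S R where [simp]: "X = (S, R)" by force
  show "on_obj V_functor X \<in> Obj CR1"
    using cring.image_ring_cring[OF Ecat_objD(1) inj_Inl] X
    by (simp add: V_functor_def CR1_def V_obj_def)
  show "on_arr V_functor X X (Ident Ecat X) = Ident CR1 (on_obj V_functor X)"
    by (rule extensionalityI[where A = "carrier (V_obj X)"])
      (simp_all add: V_functor_def CR1_def Ecat_def V_arr_extensional,
        auto simp: V_obj_carrier V_arr_Inl)
next
  fix X Y :: "'a ring \<times> 'a ring" and f
  assume X: "X \<in> Obj Ecat" and Y: "Y \<in> Obj Ecat" and f: "f \<in> Hom Ecat X Y"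
  obtain S R T M where [simp]: "X = (S, R)" "Y = (T, M)" by (metis surj_pair)
  have R: "ring R" using X Ecat_objD(1) cring.axioms(1) by auto
  have hom: "f \<in> ring_hom R M" using f by (simp add: Ecat_Hom)
  have "V_arr (S, R) (T, M) f \<in> ring_hom (V_obj (S, R)) (V_obj (T, M))"
    by (rule ring_hom_factor[OF R Inl_V_obj V_obj_carrier[symmetric]
          ring_hom_trans[OF hom Inl_V_obj]])
      (simp add: V_arr_Inl)
  then show "on_arr V_functor X Y f \<in> Hom CR1 (on_obj V_functor X) (on_obj V_functor Y)"
    by (simp add: V_functor_def CR1_def V_arr_extensional)
next
  fix X Y Z :: "'a ring \<times> 'a ring" and f g
  assume f: "f \<in> Hom Ecat X Y"
  obtain S R T M where [simp]: "X = (S, R)" "Y = (T, M)" by (metis surj_pair)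
  have "f \<in> ring_hom R M" using f by (simp add: Ecat_Hom)
  then show "on_arr V_functor X Z (Comp Ecat X Y Z g f) =
      Comp CR1 (on_obj V_functor X) (on_obj V_functor Y) (on_obj V_functor Z)
        (on_arr V_functor Y Z g) (on_arr V_functor X Y f)"
    \<comment> \<open>Both sides are \<open>undefined\<close> off \<open>carrier (V_obj X)\<close>,
      and at \<open>Inl r\<close> both equal \<open>Inl (g (f r))\<close>.\<close>
    by (intro extensionalityI[where A = "carrier (V_obj X)"])
      (simp_all add: V_functor_def CR1_def Ecat_def V_arr_extensional,
        auto simp: V_obj_carrier V_arr_Inl compose_def ring_hom_closed)
qed

text \<open>The laws are checked on cosets by \<open>Q_arr_coset\<close>. That rule asks for an
  arrow of \<open>Ecat\<close>, because preservation of \<open>psi_nil\<close> rests on the first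
  ideal being mapped onto the second; identities and composites are therefore first recognised as
  such arrows.\<close>

lemma cat_functor_Q: "cat_functor Ecat CR1 Q_functor"
proof (intro cat_functor.intro category_Ecat category_CR1 cat_functor_axioms.intro)
  fix X :: "'a ring \<times> 'a ring"
  assume X: "X \<in> Obj Ecat"
  obtain S R where XSR [simp]: "X = (S, R)" by force
  have SR: "(S, R) \<in> Obj Ecat" using X by simp
  show "on_obj Q_functor X \<in> Obj CR1"
    \<comment> \<open>The quotient may be the zero ring: if \<open>S\<close> has no prime ideals,
      \<open>psi_nil (S, R)\<close> is all of \<open>carrier R\<close>.\<close>
    using cring.image_ring_cring[OF ideal.quotient_is_cring[OF psi_nil_ideal Ecat_objD(1)] inj_Inr] SR
    by (simp add: Q_functor_def CR1_def Q_obj_def)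
  have "Ident Ecat X = (\<lambda>x\<in>carrier R. x)" by (simp add: Ecat_def)
  then show "on_arr Q_functor X X (Ident Ecat X) = Ident CR1 (on_obj Q_functor X)"
    using Q_arr_coset[OF SR SR] category.Ident_in_Hom[OF category_Ecat X]
    by (intro extensionalityI[where A = "carrier (Q_obj X)"])
      (simp_all add: Q_functor_def CR1_def Q_arr_extensional, auto simp: Q_obj_carrier)
next
  fix X Y :: "'a ring \<times> 'a ring" and f
  assume X: "X \<in> Obj Ecat" and Y: "Y \<in> Obj Ecat" and f: "f \<in> Hom Ecat X Y"
  obtain S R T M where [simp]: "X = (S, R)" "Y = (T, M)" by (metis surj_pair)
  have SR: "(S, R) \<in> Obj Ecat" "(T, M) \<in> Obj Ecat" using X Y by simp_all
  have R: "ring R" using SR Ecat_objD(1) cring.axioms(1) by auto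
  have hom: "f \<in> ring_hom R M" using f by (simp add: Ecat_Hom)
  have "Q_arr (S, R) (T, M) f \<in> ring_hom (Q_obj (S, R)) (Q_obj (T, M))"
    \<comment> \<open>Here \<open>p\<close> and the second factor of \<open>g\<close> are the coset
      maps of the two objects, and \<open>Q_arr_coset\<close> is the factorisation equation.\<close>
    by (rule ring_hom_factor[OF R coset_Q_obj[OF SR(1)] Q_obj_carrier[symmetric]
          ring_hom_trans[OF hom coset_Q_obj[OF SR(2)]]])
      (use f Q_arr_coset[OF SR] in simp)
  then show "on_arr Q_functor X Y f \<in> Hom CR1 (on_obj Q_functor X) (on_obj Q_functor Y)"
    by (simp add: Q_functor_def CR1_def Q_arr_extensional)
next
  fix X Y Z :: "'a ring \<times> 'a ring" and f g
  assume X: "X \<in> Obj Ecat" and Y: "Y \<in> Obj Ecat" and Z: "Z \<in> Obj Ecat"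
    and f: "f \<in> Hom Ecat X Y" and g: "g \<in> Hom Ecat Y Z"
  obtain S R T M U N where [simp]: "X = (S, R)" "Y = (T, M)" "Z = (U, N)" by (metis surj_pair)
  have O: "(S, R) \<in> Obj Ecat" "(T, M) \<in> Obj Ecat" "(U, N) \<in> Obj Ecat" using X Y Z by simp_all
  have hom: "f \<in> ring_hom R M" using f by (simp add: Ecat_Hom)
  have comp: "compose (carrier R) g f \<in> Hom Ecat (S, R) (U, N)"
    using category.Comp_in_Hom[OF category_Ecat X Y Z f g] by (simp add: Ecat_def)
  show "on_arr Q_functor X Z (Comp Ecat X Y Z g f) =
      Comp CR1 (on_obj Q_functor X) (on_obj Q_functor Y) (on_obj Q_functor Z)
        (on_arr Q_functor Y Z g) (on_arr Q_functor X Y f)"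
  proof (rule extensionalityI[where A = "carrier (Q_obj X)"])
    fix u assume "u \<in> carrier (Q_obj X)"
    then obtain r where r: "r \<in> carrier R" "u = Inr (psi_nil (S, R) +>\<^bsub>R\<^esub> r)"
      by (auto simp: Q_obj_carrier)
    have "Comp Ecat X Y Z g f = compose (carrier R) g f" by (simp add: Ecat_def)
    then show "on_arr Q_functor X Z (Comp Ecat X Y Z g f) u =
        Comp CR1 (on_obj Q_functor X) (on_obj Q_functor Y) (on_obj Q_functor Z)
          (on_arr Q_functor Y Z g) (on_arr Q_functor X Y f) u"
      \<comment> \<open>The rule is applied to the composite at \<open>r\<close>, to
        \<open>f\<close> at \<open>r\<close> and to \<open>g\<close> at \<open>f r\<close>; both
        sides become the coset of \<open>g (f r)\<close>.\<close>
      using r f g Q_arr_coset[OF O(1,3) comp r(1)] Q_arr_coset[OF O(1,2) _ r(1), of f]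
        Q_arr_coset[OF O(2,3) _ ring_hom_closed[OF hom r(1)], of g]
      by (simp add: Q_functor_def CR1_def compose_def Q_obj_carrier)
  qed (auto simp: Q_functor_def CR1_def Q_arr_extensional)
qed

section \<open>The natural transformation\<close>

lemma theta_Inl: "r \<in> carrier R \<Longrightarrow> theta (S, R) (Inl r) = Inr (psi_nil (S, R) +>\<^bsub>R\<^esub> r)"
  by (simp add: theta_def V_obj_carrier)

lemma theta_extensional: "theta X \<in> extensional (carrier (V_obj X))"
  by (simp add: theta_def)

theorem proposition9:
  shows "natural_transformation
    (Ecat :: ('a ring \<times> 'a ring, 'a \<Rightarrow> 'a) cat) CR1 V_functor Q_functor theta"
proof (intro natural_transformation.intro cat_functor_V cat_functor_Q
    natural_transformation_axioms.intro)
  fix X :: "'a ring \<times> 'a ring"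
  assume X: "X \<in> Obj Ecat"
  obtain S R where XSR [simp]: "X = (S, R)" by force
  have R: "ring R" using X Ecat_objD(1) cring.axioms(1) by auto
  \<comment> \<open>Composed with the surjection \<open>Inl\<close>, \<open>theta X\<close> becomes
    the coset map, a homomorphism by \<open>coset_Q_obj\<close>.\<close>
  have "theta X \<in> ring_hom (V_obj X) (Q_obj X)"
    using ring_hom_factor[OF R Inl_V_obj V_obj_carrier[symmetric] coset_Q_obj] X
    by (simp add: theta_Inl)
  then show "theta X \<in> Hom CR1 (on_obj V_functor X) (on_obj Q_functor X)"
    by (simp add: V_functor_def Q_functor_def CR1_def theta_extensional)
next
  fix X Y :: "'a ring \<times> 'a ring" and f
  assume X: "X \<in> Obj Ecat" and Y: "Y \<in> Obj Ecat" and f: "f \<in> Hom Ecat X Y"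
  obtain S R T M where [simp]: "X = (S, R)" "Y = (T, M)" by (metis surj_pair)
  have "f \<in> ring_hom R M" using f by (simp add: Ecat_Hom)
  then show "Comp CR1 (on_obj V_functor X) (on_obj V_functor Y) (on_obj Q_functor Y)
        (theta Y) (on_arr V_functor X Y f) =
      Comp CR1 (on_obj V_functor X) (on_obj Q_functor X) (on_obj Q_functor Y)
        (on_arr Q_functor X Y f) (theta X)"
    \<comment> \<open>At \<open>Inl r\<close> both paths give the coset of \<open>f r\<close> modulo
      \<open>psi_nil Y\<close>: one by \<open>theta_Inl\<close> at \<open>f r\<close>, the other by
      \<open>Q_arr_coset\<close> at \<open>r\<close>.\<close>
    using X Y f Q_arr_coset[of S R T M f]
    by (intro extensionalityI[where A = "carrier (V_obj X)"])
      (auto simp: V_functor_def Q_functor_def CR1_def V_obj_carrier V_arr_Inl theta_Inl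
        compose_def ring_hom_closed)
qed

end
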